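(* The functor $\operatorname{Clop}_{\uparrow}: {}^{\mathrm{MV}}\mathrm{Top}_{\le} \to ({}^{\mathrm{MV}}\mathcal{L})^{\mathrm{op}}$ is left adjoint to the functor $\Upsilon: ({}^{\mathrm{MV}}\mathcal{L})^{\mathrm{op}} \to {}^{\mathrm{MV}}\mathrm{Top}_{\le}$. The unit of the adjunction is given, for each partially ordered MV-space $(X,\tau,\le)$, by $$\eta_X : X \to \Upsilon \operatorname{Clop}_{\uparrow}\tau,\quad x \mapsto f_x, \qquad\text{where } f_x : \operatorname{Clop}_{\uparrow}\tau \to [0,1],\ \alpha \mapsto \alpha(x),$$ and the counit is given, for each MV-lattice $A$, by the MV-lattice homomorphism $$\varepsilon_A : A \to \operatorname{Clop}_{\uparrow}\Upsilon A,\quad a \mapsto \tilde a,\qquad \text{where } \tilde a : H_A \to [0,1],\ f \mapsto f(a)$$ (a morphism $\operatorname{Clop}_{\uparrow}\Upsilon A \to A$ in $({}^{\mathrm{MV}}\mathcal{L})^{\mathrm{op}}$).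
   Context: MV-algebras $(A,\oplus,{}^*,0)$ are as usual, with $1=0^*$, $a\odot b=(a^*\oplus b^* )^*$, $a\vee b=(a^*\oplus b)^*\oplus b$, $a\wedge b=(a^*\vee b^* )^*$. On $[0,1]$: $x\oplus y=\min(1,x+y)$, $x^*=1-x$, $x\odot y=\max(0,x+y-1)$; $[0,1]^X$ carries the pointwise operations. An MV-lattice is an algebra $(A,+,\cdot,\vee,\wedge,0,1)$ such that $(A,\vee,\wedge,0,1)$ is a bounded distributive lattice, $+$ and $\cdot$ are commutative operations that distribute over $\vee$ and $\wedge$, and $x\cdot 1=x$, $x+0=x$, $(x\cdot y)\vee(x\wedge y)=x\wedge y$ for all $x,y$. An MV-lattice homomorphism is a bounded lattice homomorphism preserving $+$ and $\cdot$. ${}^{\mathrm{MV}}\mathcal{L}$ is the category of MV-lattices and their homomorphisms. $[0,1]$ is an MV-lattice with $+=\oplus$, $\cdot=\odot$. An MV-space (MV-topological space) is a pair $(X,\tau)$, $X$ a set and $\tau\subseteq[0,1]^X$ containing the constants $\mathbf 0,\mathbf 1$, closed under arbitrary (pointwise) joins and under the binary operations $\odot,\oplus,\wedge$. Elements of $\tau$ are open; closed sets are the elements of $\tau^*=\{\alpha^*:\alpha\in\tau\}$; clopens are elements of $\tau\cap\tau^*$. A map $f:X\to Y$ between MV-spaces is continuous if $\alpha\circ f\in\tau_X$ for all $\alpha\in\tau_Y$. A base of $\tau$ is a subset of $\tau$ such that every open is a join of its elements. A partially ordered MV-space is a triple $(X,\tau,\le)$ with $(X,\tau)$ an MV-space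 and $\le$ a partial order on $X$. ${}^{\mathrm{MV}}\mathrm{Top}_{\le}$ is the category of partially ordered MV-spaces with continuous order-preserving maps. A fuzzy set $\alpha\in[0,1]^X$ is increasing if $x\le y$ implies $\alpha(x)\le\alpha(y)$. The functor $\operatorname{Clop}_{\uparrow}$ sends $(X,\tau,\le)$ to the MV-lattice $\operatorname{Clop}_{\uparrow}\tau$ (also written $\operatorname{Clop}_{\uparrow}X$) of increasing clopens, with pointwise operations $\oplus,\odot,\vee,\wedge$, and sends $f:X\to Y$ to $\operatorname{Clop}_{\uparrow}\tau_Y\to\operatorname{Clop}_{\uparrow}\tau_X$, $\alpha\mapsto\alpha\circ f$. For an MV-lattice $A$, $H_A$ is the set of MV-lattice homomorphisms $A\to[0,1]$, ordered by $f\le g$ iff $f(a)\le g(a)$ for all $a\in A$. Let $\tilde A=\{\tilde a: a\in A\}\subseteq[0,1]^{H_A}$, where $\tilde a(f)=f(a)$, and let $B=\langle\tilde A\rangle$ be the MV-subalgebra of $[0,1]^{H_A}$ generated by $\tilde A$; $\tau_A$ is the MV-topology on $H_A$ having $B$ as a base. The functor $\Upsilon$ sends $A$ to $(H_A,\tau_A,\le_A)$ and an MV-lattice homomorphism $q:A\to C$ to $\Upsilon q:H_C\to H_A$, $h\mapsto h\circ q$. *)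

theory Defs
  imports Complex_Main "HOL-Library.FuncSet"
begin

section \<open>The standard MV-algebra and pointwise operations\<close>

text \<open>The following are only used on \<open>[0,1]\<close>.\<close>

definition mv_plus :: "real \<Rightarrow> real \<Rightarrow> real" where
  "mv_plus x y = min 1 (x + y)"

definition mv_times :: "real \<Rightarrow> real \<Rightarrow> real" where
  "mv_times x y = max 0 (x + y - 1)"

definition mv_neg :: "real \<Rightarrow> real" where
  "mv_neg x = 1 - x"

text \<open>The derived operations of the MV-algebra \<open>[0,1]\<close> are \<open>mv_times\<close>, \<^const>\<open>max\<close> and \<^const>\<open>min\<close>.\<close>

lemma mv_derived_operations:
  assumes "x \<in> {0..1}" "y \<in> {0..1}"
  shows "mv_times x y = mv_neg (mv_plus (mv_neg x) (mv_neg y))"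
    and "max x y = mv_plus (mv_neg (mv_plus (mv_neg x) y)) y"
    and "min x y = mv_neg (max (mv_neg x) (mv_neg y))"
  using assms by (auto simp: mv_times_def mv_plus_def mv_neg_def max_def min_def)

text \<open>
  Fuzzy sets, like all maps between structures with a carrier set, are extensional functions
  (elements of \<open>X \<rightarrow>\<^sub>E Y\<close>), so that equality of functions is equality on the carrier.
\<close>

type_synonym 'a fuzzy = "'a \<Rightarrow> real"

definition fuzzy_sets :: "'a set \<Rightarrow> 'a fuzzy set" where
  "fuzzy_sets X = (X \<rightarrow>\<^sub>E {0..1})"

definition fconst :: "'a set \<Rightarrow> real \<Rightarrow> 'a fuzzy" where
  "fconst X c = (\<lambda>x\<in>X. c)"

definition fplus :: "'a set \<Rightarrow> 'a fuzzy \<Rightarrow> 'a fuzzy \<Rightarrow> 'a fuzzy" where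
  "fplus X \<alpha> \<beta> = (\<lambda>x\<in>X. mv_plus (\<alpha> x) (\<beta> x))"

definition ftimes :: "'a set \<Rightarrow> 'a fuzzy \<Rightarrow> 'a fuzzy \<Rightarrow> 'a fuzzy" where
  "ftimes X \<alpha> \<beta> = (\<lambda>x\<in>X. mv_times (\<alpha> x) (\<beta> x))"

definition fjoin :: "'a set \<Rightarrow> 'a fuzzy \<Rightarrow> 'a fuzzy \<Rightarrow> 'a fuzzy" where
  "fjoin X \<alpha> \<beta> = (\<lambda>x\<in>X. max (\<alpha> x) (\<beta> x))"

definition fmeet :: "'a set \<Rightarrow> 'a fuzzy \<Rightarrow> 'a fuzzy \<Rightarrow> 'a fuzzy" where
  "fmeet X \<alpha> \<beta> = (\<lambda>x\<in>X. min (\<alpha> x) (\<beta> x))"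

definition fneg :: "'a set \<Rightarrow> 'a fuzzy \<Rightarrow> 'a fuzzy" where
  "fneg X \<alpha> = (\<lambda>x\<in>X. mv_neg (\<alpha> x))"

text \<open>
  The pointwise join of a family in \<open>[0,1]\<^sup>X\<close>. Inserting \<open>0\<close> does not change the supremum of a
  nonempty family and gives the empty family its join in \<open>[0,1]\<^sup>X\<close>, the constant \<open>0\<close>
  (\<open>Sup {}\<close> is unspecified on the reals).
\<close>

definition fSup :: "'a set \<Rightarrow> 'a fuzzy set \<Rightarrow> 'a fuzzy" where
  "fSup X S = (\<lambda>x\<in>X. Sup (insert 0 ((\<lambda>\<alpha>. \<alpha> x) ` S)))"


section \<open>MV-lattices\<close>

record 'a mvl =
  lcarrier :: "'a set"
  ladd :: "'a \<Rightarrow> 'a \<Rightarrow> 'a"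
  lmul :: "'a \<Rightarrow> 'a \<Rightarrow> 'a"
  ljoin :: "'a \<Rightarrow> 'a \<Rightarrow> 'a"
  lmeet :: "'a \<Rightarrow> 'a \<Rightarrow> 'a"
  lzero :: 'a
  lone :: 'a

definition bounded_distrib_lattice_on ::
  "'a set \<Rightarrow> ('a \<Rightarrow> 'a \<Rightarrow> 'a) \<Rightarrow> ('a \<Rightarrow> 'a \<Rightarrow> 'a) \<Rightarrow> 'a \<Rightarrow> 'a \<Rightarrow> bool" where
  "bounded_distrib_lattice_on L j m b t \<longleftrightarrow>
     b \<in> L \<and> t \<in> L \<and>
     (\<forall>x\<in>L. \<forall>y\<in>L. j x y \<in> L \<and> m x y \<in> L) \<and>
     (\<forall>x\<in>L. \<forall>y\<in>L. j x y = j y x \<and> m x y = m y x) \<and>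
     (\<forall>x\<in>L. \<forall>y\<in>L. \<forall>z\<in>L. j (j x y) z = j x (j y z) \<and> m (m x y) z = m x (m y z)) \<and>
     (\<forall>x\<in>L. \<forall>y\<in>L. j x (m x y) = x \<and> m x (j x y) = x) \<and>
     (\<forall>x\<in>L. \<forall>y\<in>L. \<forall>z\<in>L. m x (j y z) = j (m x y) (m x z)) \<and>
     (\<forall>x\<in>L. j b x = x \<and> m t x = x)"

definition mv_lattice :: "'a mvl \<Rightarrow> bool" where
  "mv_lattice A \<longleftrightarrow>
     bounded_distrib_lattice_on (lcarrier A) (ljoin A) (lmeet A) (lzero A) (lone A) \<and>
     (\<forall>x\<in>lcarrier A. \<forall>y\<in>lcarrier A.
        ladd A x y \<in> lcarrier A \<and> lmul A x y \<in> lcarrier A \<and>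
        ladd A x y = ladd A y x \<and> lmul A x y = lmul A y x) \<and>
     (\<forall>x\<in>lcarrier A. \<forall>y\<in>lcarrier A. \<forall>z\<in>lcarrier A.
        ladd A x (ljoin A y z) = ljoin A (ladd A x y) (ladd A x z) \<and>
        ladd A x (lmeet A y z) = lmeet A (ladd A x y) (ladd A x z) \<and>
        lmul A x (ljoin A y z) = ljoin A (lmul A x y) (lmul A x z) \<and>
        lmul A x (lmeet A y z) = lmeet A (lmul A x y) (lmul A x z)) \<and>
     (\<forall>x\<in>lcarrier A. lmul A x (lone A) = x \<and> ladd A x (lzero A) = x) \<and>
     (\<forall>x\<in>lcarrier A. \<forall>y\<in>lcarrier A.
        ljoin A (lmul A x y) (lmeet A x y) = lmeet A x y)"

definition mvl_hom :: "'a mvl \<Rightarrow> 'b mvl \<Rightarrow> ('a \<Rightarrow> 'b) set" where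
  "mvl_hom A C = {h \<in> lcarrier A \<rightarrow>\<^sub>E lcarrier C.
     h (lzero A) = lzero C \<and> h (lone A) = lone C \<and>
     (\<forall>x\<in>lcarrier A. \<forall>y\<in>lcarrier A.
        h (ljoin A x y) = ljoin C (h x) (h y) \<and>
        h (lmeet A x y) = lmeet C (h x) (h y) \<and>
        h (ladd A x y) = ladd C (h x) (h y) \<and>
        h (lmul A x y) = lmul C (h x) (h y))}"

definition mvl_id :: "'a mvl \<Rightarrow> 'a \<Rightarrow> 'a" where
  "mvl_id A = (\<lambda>a\<in>lcarrier A. a)"

definition unit_interval_mvl :: "real mvl" where
  "unit_interval_mvl = \<lparr>lcarrier = {0..1}, ladd = mv_plus, lmul = mv_times,
     ljoin = max, lmeet = min, lzero = 0, lone = 1\<rparr>"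

lemma mv_lattice_unit_interval: "mv_lattice unit_interval_mvl"
  by (auto simp: mv_lattice_def bounded_distrib_lattice_on_def unit_interval_mvl_def
      mv_plus_def mv_times_def max_def min_def)

lemma mvl_id_in_hom: "mv_lattice A \<Longrightarrow> mvl_id A \<in> mvl_hom A A"
  by (auto simp: mv_lattice_def bounded_distrib_lattice_on_def mvl_hom_def mvl_id_def)

lemma mvl_hom_compose:
  assumes "mv_lattice A" "q \<in> mvl_hom A C" "r \<in> mvl_hom C D"
  shows "compose (lcarrier A) r q \<in> mvl_hom A D"
proof -
  have q: "q x \<in> lcarrier C" if "x \<in> lcarrier A" for x
    using assms(2) that by (auto simp: mvl_hom_def)
  have closed: "lzero A \<in> lcarrier A" "lone A \<in> lcarrier A"
    "\<And>x y. x \<in> lcarrier A \<Longrightarrow> y \<in> lcarrier A \<Longrightarrow>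
      ljoin A x y \<in> lcarrier A \<and> lmeet A x y \<in> lcarrier A \<and>
      ladd A x y \<in> lcarrier A \<and> lmul A x y \<in> lcarrier A"
    using assms(1) by (simp_all add: mv_lattice_def bounded_distrib_lattice_on_def)
  show ?thesis
    using assms(2,3) q closed by (auto simp: mvl_hom_def compose_def)
qed


section \<open>Partially ordered MV-spaces\<close>

definition mv_topology :: "'a set \<Rightarrow> 'a fuzzy set \<Rightarrow> bool" where
  "mv_topology X \<tau> \<longleftrightarrow>
     \<tau> \<subseteq> fuzzy_sets X \<and> fconst X 0 \<in> \<tau> \<and> fconst X 1 \<in> \<tau> \<and>
     (\<forall>S. S \<subseteq> \<tau> \<longrightarrow> fSup X S \<in> \<tau>) \<and>
     (\<forall>\<alpha>\<in>\<tau>. \<forall>\<beta>\<in>\<tau>. ftimes X \<alpha> \<beta> \<in> \<tau> \<and> fplus X \<alpha> \<beta> \<in> \<tau> \<and> fmeet X \<alpha> \<beta> \<in> \<tau>)"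

definition mv_closed_sets :: "'a set \<Rightarrow> 'a fuzzy set \<Rightarrow> 'a fuzzy set" where
  "mv_closed_sets X \<tau> = fneg X ` \<tau>"

definition mv_clopens :: "'a set \<Rightarrow> 'a fuzzy set \<Rightarrow> 'a fuzzy set" where
  "mv_clopens X \<tau> = \<tau> \<inter> mv_closed_sets X \<tau>"

definition mv_base :: "'a set \<Rightarrow> 'a fuzzy set \<Rightarrow> 'a fuzzy set \<Rightarrow> bool" where
  "mv_base X \<tau> B \<longleftrightarrow> B \<subseteq> \<tau> \<and> (\<forall>\<alpha>\<in>\<tau>. \<exists>S\<subseteq>B. \<alpha> = fSup X S)"

record 'a pomv =
  pts :: "'a set"
  opens :: "'a fuzzy set"
  ple :: "'a rel"

definition pomv_space :: "'a pomv \<Rightarrow> bool" where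
  "pomv_space X \<longleftrightarrow> mv_topology (pts X) (opens X) \<and> partial_order_on (pts X) (ple X)"

definition pomv_hom :: "'a pomv \<Rightarrow> 'b pomv \<Rightarrow> ('a \<Rightarrow> 'b) set" where
  "pomv_hom X Y = {f \<in> pts X \<rightarrow>\<^sub>E pts Y.
     (\<forall>\<alpha>\<in>opens Y. compose (pts X) \<alpha> f \<in> opens X) \<and>
     (\<forall>(x, y)\<in>ple X. (f x, f y) \<in> ple Y)}"

definition pomv_id :: "'a pomv \<Rightarrow> 'a \<Rightarrow> 'a" where
  "pomv_id X = (\<lambda>x\<in>pts X. x)"

lemma pomv_id_in_hom: 
  assumes "pomv_space X" 
  shows "pomv_id X \<in> pomv_hom X X"
proof -
  have "compose (pts X) \<alpha> (pomv_id X) = \<alpha>" if "\<alpha> \<in> opens X" for \<alpha>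
  proof -
    have "\<alpha> \<in> fuzzy_sets (pts X)"
      using assms that by (auto simp: pomv_space_def mv_topology_def)
    then show ?thesis
      unfolding fuzzy_sets_def pomv_id_def by (auto intro!: compose_Id simp: PiE_def)
  qed
  moreover have "ple X \<subseteq> pts X \<times> pts X"
    using assms partial_order_onD(4) by (auto simp: pomv_space_def)
  ultimately show ?thesis
    by (auto simp: pomv_hom_def pomv_id_def)
qed

lemma pomv_hom_compose:
  assumes "pomv_space X" "f \<in> pomv_hom X Y" "g \<in> pomv_hom Y Z"
  shows "compose (pts X) g f \<in> pomv_hom X Z"
proof -
  have f: "f \<in> pts X \<rightarrow> pts Y" and g: "g \<in> pts Y \<rightarrow> pts Z"
    using assms by (auto simp: pomv_hom_def)
  have "compose (pts X) \<alpha> (compose (pts X) g f) \<in> opens X" if "\<alpha> \<in> opens Z" for \<alpha>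
  proof -
    have "compose (pts X) \<alpha> (compose (pts X) g f) = compose (pts X) (compose (pts Y) \<alpha> g) f"
      using f by (rule compose_assoc)
    then show ?thesis
      using assms that by (auto simp: pomv_hom_def)
  qed
  moreover have "ple X \<subseteq> pts X \<times> pts X"
    using assms partial_order_onD(4) by (auto simp: pomv_space_def)
  ultimately show ?thesis
    using assms f g by (fastforce simp: pomv_hom_def compose_def)
qed

definition increasing :: "'a pomv \<Rightarrow> 'a fuzzy \<Rightarrow> bool" where
  "increasing X \<alpha> \<longleftrightarrow> (\<forall>(x, y)\<in>ple X. \<alpha> x \<le> \<alpha> y)"


section \<open>The two functors\<close>

text \<open>
  Morphisms of the opposite category from \<open>A\<close> to \<open>C\<close> are the elements of \<open>mvl_hom C A\<close>, and
  both functors are written below as contravariant ones. Since \<open>Clop\<close> and \<open>Upsilon\<close> raise the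
  type of the underlying set, the hom sets are defined between structures over different types;
  statements about the functors quantify over objects that each have their own type variable.
\<close>

definition Clop :: "'a pomv \<Rightarrow> 'a fuzzy mvl" where
  "Clop X = \<lparr>lcarrier = {\<alpha> \<in> mv_clopens (pts X) (opens X). increasing X \<alpha>},
     ladd = fplus (pts X), lmul = ftimes (pts X),
     ljoin = fjoin (pts X), lmeet = fmeet (pts X),
     lzero = fconst (pts X) 0, lone = fconst (pts X) 1\<rparr>"

definition Clop_map :: "'a pomv \<Rightarrow> 'b pomv \<Rightarrow> ('a \<Rightarrow> 'b) \<Rightarrow> 'b fuzzy \<Rightarrow> 'a fuzzy" where
  "Clop_map X Y f = (\<lambda>\<alpha>\<in>lcarrier (Clop Y). compose (pts X) \<alpha> f)"

definition H_set :: "'a mvl \<Rightarrow> ('a \<Rightarrow> real) set" where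
  "H_set A = mvl_hom A unit_interval_mvl"

definition H_le :: "'a mvl \<Rightarrow> ('a \<Rightarrow> real) rel" where
  "H_le A = {(f, g). f \<in> H_set A \<and> g \<in> H_set A \<and> (\<forall>a\<in>lcarrier A. f a \<le> g a)}"

definition tilde :: "'a mvl \<Rightarrow> 'a \<Rightarrow> ('a \<Rightarrow> real) fuzzy" where
  "tilde A a = (\<lambda>f\<in>H_set A. f a)"

definition mv_subalgebra :: "'a set \<Rightarrow> 'a fuzzy set \<Rightarrow> bool" where
  "mv_subalgebra X S \<longleftrightarrow> S \<subseteq> fuzzy_sets X \<and> fconst X 0 \<in> S \<and>
     (\<forall>\<alpha>\<in>S. fneg X \<alpha> \<in> S) \<and> (\<forall>\<alpha>\<in>S. \<forall>\<beta>\<in>S. fplus X \<alpha> \<beta> \<in> S)"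

definition Upsilon_base :: "'a mvl \<Rightarrow> ('a \<Rightarrow> real) fuzzy set" where
  "Upsilon_base A = mv_subalgebra (H_set A) hull (tilde A ` lcarrier A)"

text \<open>A topology with a prescribed base consists of all joins of members of the base.\<close>

definition topology_of_base :: "'a set \<Rightarrow> 'a fuzzy set \<Rightarrow> 'a fuzzy set" where
  "topology_of_base X B = {fSup X S |S. S \<subseteq> B}"

lemma topology_of_base_unique:
  assumes "mv_topology X \<tau>" "mv_base X \<tau> B"
  shows "\<tau> = topology_of_base X B"
  using assms unfolding mv_topology_def mv_base_def topology_of_base_def by blast

lemma mv_base_topology_of_base:
  assumes "B \<subseteq> fuzzy_sets X"
  shows "mv_base X (topology_of_base X B) B"
proof -
  have "\<beta> = fSup X {\<beta>}" if "\<beta> \<in> B" for \<beta>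
  proof
    fix x
    have \<beta>: "\<beta> \<in> X \<rightarrow>\<^sub>E {0..1}" using that assms by (auto simp: fuzzy_sets_def)
    show "\<beta> x = fSup X {\<beta>} x"
    proof (cases "x \<in> X")
      case True
      then have "0 \<le> \<beta> x" using \<beta> by (auto dest: PiE_mem)
      then have "Sup {0, \<beta> x} = \<beta> x" by (intro cSup_eq_maximum) auto
      with True show ?thesis by (simp add: fSup_def)
    next
      case False
      with \<beta> show ?thesis by (simp add: fSup_def PiE_arb[OF \<beta>])
    qed
  qed
  then show ?thesis
    unfolding mv_base_def topology_of_base_def by blast
qed

definition Upsilon :: "'a mvl \<Rightarrow> ('a \<Rightarrow> real) pomv" where
  "Upsilon A = \<lparr>pts = H_set A, opens = topology_of_base (H_set A) (Upsilon_base A), ple = H_le A\<rparr>"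

definition Upsilon_map :: "'a mvl \<Rightarrow> 'b mvl \<Rightarrow> ('a \<Rightarrow> 'b) \<Rightarrow> ('b \<Rightarrow> real) \<Rightarrow> 'a \<Rightarrow> real" where
  "Upsilon_map A C q = (\<lambda>h\<in>H_set C. compose (lcarrier A) h q)"


section \<open>Unit, counit and transposition\<close>

definition adj_unit :: "'a pomv \<Rightarrow> 'a \<Rightarrow> 'a fuzzy \<Rightarrow> real" where
  "adj_unit X = (\<lambda>x\<in>pts X. \<lambda>\<alpha>\<in>lcarrier (Clop X). \<alpha> x)"

definition adj_counit :: "'a mvl \<Rightarrow> 'a \<Rightarrow> ('a \<Rightarrow> real) fuzzy" where
  "adj_counit A = (\<lambda>a\<in>lcarrier A. tilde A a)"

text \<open>
  The map from morphisms \<open>Clop X \<rightarrow> A\<close> of the opposite category to morphisms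
  \<open>X \<rightarrow> Upsilon A\<close> that is induced by the unit, and the map in the other direction
  that is induced by the counit.
\<close>

definition adj_transpose :: "'a pomv \<Rightarrow> 'b mvl \<Rightarrow> ('b \<Rightarrow> 'a fuzzy) \<Rightarrow> 'a \<Rightarrow> 'b \<Rightarrow> real" where
  "adj_transpose X A q = compose (pts X) (Upsilon_map A (Clop X) q) (adj_unit X)"

definition adj_cotranspose :: "'a pomv \<Rightarrow> 'b mvl \<Rightarrow> ('a \<Rightarrow> 'b \<Rightarrow> real) \<Rightarrow> 'b \<Rightarrow> 'a fuzzy" where
  "adj_cotranspose X A f = compose (lcarrier A) (Clop_map X (Upsilon A) f) (adj_counit A)"

end

theory Submission
  imports Defs
begin

text \<open>
  A homomorphism \<open>q : A \<rightarrow> Clop X\<close> and a morphism \<open>f : X \<rightarrow> Upsilon A\<close> are two curried forms of the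
  same function of a point \<open>x\<close> and a lattice element \<open>a\<close> with values in \<open>[0,1]\<close>, related by
  \<open>f x a = q a x\<close>. In this way the unit arises from the identity of \<open>Clop X\<close> and the
  counit from the identity of \<open>Upsilon A\<close>. Hence the adjunction amounts to the fact that exchanging
  the arguments (\<open>swap_args\<close>) takes morphisms to morphisms in both directions
  (\<open>swap_args_pomv_hom\<close>, \<open>swap_args_mvl_hom\<close>).

  The algebraic conditions correspond because the operations of \<open>Clop X\<close> are pointwise: \<open>q\<close>
  preserves them iff every \<open>f x\<close> does. The order conditions correspond because the order of
  \<open>Upsilon A\<close> is pointwise: \<open>f\<close> is order-preserving iff every \<open>q a\<close> is increasing. For the
  topological condition, observe that \<open>q a\<close> is the preimage of \<open>tilde A a\<close> under \<open>f\<close>, and that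
  \<open>tilde A a\<close> is clopen because the base of \<open>Upsilon A\<close> is closed under negation; so continuity of
  \<open>f\<close> makes every \<open>q a\<close> clopen. Conversely (\<open>continuous_into_Upsilon\<close>), the fuzzy sets with
  clopen preimage form an MV-subalgebra; if it contains all \<open>tilde A a\<close>, it contains the base,
  and \<open>f\<close> is continuous since taking preimages commutes with joins.

  What has to be checked beforehand is that the two functors have values in the right categories:
  \<open>Clop X\<close> inherits its identities from \<open>[0,1]\<close>, and the joins of members of an MV-subalgebra form
  an MV-topology because the operations of \<open>[0,1]\<close> are monotone and continuous and therefore
  commute with suprema (\<open>mv_topology_topology_of_base\<close>). The action of both functors on morphisms
  is then obtained from \<open>swap_args\<close> too, and the naturality and triangle identities are equalities
  of functions that hold argument by argument.
\<close>

section \<open>Fuzzy sets and MV-topologies\<close>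

lemmas fuzzy_op_defs =
  fconst_def fplus_def ftimes_def fjoin_def fmeet_def fneg_def fSup_def
  mv_plus_def mv_times_def mv_neg_def

lemma fuzzy_sets_range: "\<alpha> \<in> fuzzy_sets X \<Longrightarrow> x \<in> X \<Longrightarrow> 0 \<le> \<alpha> x \<and> \<alpha> x \<le> 1"
  unfolding fuzzy_sets_def by (drule (1) PiE_mem) simp

lemma fuzzy_set_eqI:
  assumes "\<alpha> \<in> fuzzy_sets X" "\<beta> \<in> fuzzy_sets X" "\<And>x. x \<in> X \<Longrightarrow> \<alpha> x = \<beta> x"
  shows "\<alpha> = \<beta>"
  using assms unfolding fuzzy_sets_def by (rule PiE_ext)

lemma fuzzy_sets_closed:
  assumes "\<alpha> \<in> fuzzy_sets X" "\<beta> \<in> fuzzy_sets X"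
  shows "fplus X \<alpha> \<beta> \<in> fuzzy_sets X" "ftimes X \<alpha> \<beta> \<in> fuzzy_sets X"
    "fjoin X \<alpha> \<beta> \<in> fuzzy_sets X" "fmeet X \<alpha> \<beta> \<in> fuzzy_sets X" "fneg X \<alpha> \<in> fuzzy_sets X"
  using fuzzy_sets_range[OF assms(1)] fuzzy_sets_range[OF assms(2)]
  by (force simp: fuzzy_sets_def fuzzy_op_defs max_def min_def)+

lemma fconst_fuzzy_sets: "0 \<le> c \<Longrightarrow> c \<le> 1 \<Longrightarrow> fconst X c \<in> fuzzy_sets X"
  by (auto simp: fuzzy_sets_def fconst_def)

lemma fneg_fneg: "\<alpha> \<in> fuzzy_sets X \<Longrightarrow> fneg X (fneg X \<alpha>) = \<alpha>"
  by (rule fuzzy_set_eqI[of _ X]) (simp_all add: fuzzy_sets_closed, simp add: fneg_def mv_neg_def)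

lemma fuzzy_de_morgan:
  "fneg X (fplus X \<alpha> \<beta>) = ftimes X (fneg X \<alpha>) (fneg X \<beta>)"
  "fneg X (ftimes X \<alpha> \<beta>) = fplus X (fneg X \<alpha>) (fneg X \<beta>)"
  "fneg X (fjoin X \<alpha> \<beta>) = fmeet X (fneg X \<alpha>) (fneg X \<beta>)"
  "fneg X (fmeet X \<alpha> \<beta>) = fjoin X (fneg X \<alpha>) (fneg X \<beta>)"
  "fneg X (fconst X 0) = fconst X 1" "fneg X (fconst X 1) = fconst X 0"
  by (auto simp: fuzzy_op_defs max_def min_def fun_eq_iff restrict_def)

lemma fSup_fuzzy_sets:
  assumes "S \<subseteq> fuzzy_sets X"
  shows "fSup X S \<in> fuzzy_sets X"
proof -
  have "0 \<le> Sup (insert 0 ((\<lambda>\<alpha>. \<alpha> x) ` S)) \<and> Sup (insert 0 ((\<lambda>\<alpha>. \<alpha> x) ` S)) \<le> 1" if "x \<in> X" for x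
  proof
    have le1: "t \<le> 1" if "t \<in> insert 0 ((\<lambda>\<alpha>. \<alpha> x) ` S)" for t
      using that fuzzy_sets_range[OF _ \<open>x \<in> X\<close>] assms by auto
    then show "0 \<le> Sup (insert 0 ((\<lambda>\<alpha>. \<alpha> x) ` S))"
      by (intro cSup_upper bdd_aboveI[where M = 1]) auto
    show "Sup (insert 0 ((\<lambda>\<alpha>. \<alpha> x) ` S)) \<le> 1"
      using le1 by (intro cSup_least) auto
  qed
  then show ?thesis by (auto simp: fuzzy_sets_def fSup_def)
qed

lemma fjoin_eq_fSup:
  assumes "\<alpha> \<in> fuzzy_sets X" "\<beta> \<in> fuzzy_sets X"
  shows "fjoin X \<alpha> \<beta> = fSup X {\<alpha>, \<beta>}"
proof (rule fuzzy_set_eqI[of _ X])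
  fix x assume x: "x \<in> X"
  have "Sup {0, \<alpha> x, \<beta> x} = max (\<alpha> x) (\<beta> x)"
    using fuzzy_sets_range[OF assms(1) x] fuzzy_sets_range[OF assms(2) x]
    by (intro cSup_eq_maximum) (auto simp: max_def)
  with x show "fjoin X \<alpha> \<beta> x = fSup X {\<alpha>, \<beta>} x" by (simp add: fjoin_def fSup_def)
qed (use assms in \<open>auto intro!: fuzzy_sets_closed fSup_fuzzy_sets\<close>)

lemma mv_topology_fuzzy: "mv_topology X \<tau> \<Longrightarrow> \<alpha> \<in> \<tau> \<Longrightarrow> \<alpha> \<in> fuzzy_sets X"
  by (auto simp: mv_topology_def)

lemma mv_topology_closed:
  assumes "mv_topology X \<tau>" "\<alpha> \<in> \<tau>" "\<beta> \<in> \<tau>"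
  shows "fplus X \<alpha> \<beta> \<in> \<tau>" "ftimes X \<alpha> \<beta> \<in> \<tau>" "fjoin X \<alpha> \<beta> \<in> \<tau>" "fmeet X \<alpha> \<beta> \<in> \<tau>"
  using assms by (auto simp: mv_topology_def fjoin_eq_fSup subset_iff)

lemma mv_clopens_iff:
  assumes "mv_topology X \<tau>"
  shows "\<alpha> \<in> mv_clopens X \<tau> \<longleftrightarrow> \<alpha> \<in> \<tau> \<and> fneg X \<alpha> \<in> \<tau>"
  using mv_topology_fuzzy[OF assms]
  by (auto simp: mv_clopens_def mv_closed_sets_def fneg_fneg image_iff) (metis fneg_fneg)

lemma mv_clopens_closed:
  assumes "mv_topology X \<tau>" "\<alpha> \<in> mv_clopens X \<tau>" "\<beta> \<in> mv_clopens X \<tau>"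
  shows "fplus X \<alpha> \<beta> \<in> mv_clopens X \<tau>" "ftimes X \<alpha> \<beta> \<in> mv_clopens X \<tau>"
    "fjoin X \<alpha> \<beta> \<in> mv_clopens X \<tau>" "fmeet X \<alpha> \<beta> \<in> mv_clopens X \<tau>"
    "fneg X \<alpha> \<in> mv_clopens X \<tau>"
  using assms(2,3) mv_topology_closed[OF assms(1)] mv_topology_fuzzy[OF assms(1)]
  by (auto simp: mv_clopens_iff[OF assms(1)] fuzzy_de_morgan fneg_fneg)

lemma fconst_mv_clopens:
  "mv_topology X \<tau> \<Longrightarrow> fconst X 0 \<in> mv_clopens X \<tau>"
  "mv_topology X \<tau> \<Longrightarrow> fconst X 1 \<in> mv_clopens X \<tau>"
  by (simp_all add: mv_clopens_iff fuzzy_de_morgan, simp_all add: mv_topology_def)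

text \<open>
  Closedness of an open \<open>\<alpha>\<close> means that its negation is open, a symmetric condition; with the De
  Morgan laws this makes the clopens stable under all MV-operations.
\<close>

lemma mv_subalgebra_mv_clopens:
  assumes "mv_topology X \<tau>"
  shows "mv_subalgebra X (mv_clopens X \<tau>)"
  using mv_clopens_closed[OF assms] fconst_mv_clopens[OF assms] mv_topology_fuzzy[OF assms]
  by (auto simp: mv_subalgebra_def mv_clopens_iff[OF assms])


section \<open>The MV-topology of joins of an MV-subalgebra\<close>

lemma mv_subalgebra_closed:
  assumes B: "mv_subalgebra X B" and "\<alpha> \<in> B" "\<beta> \<in> B"
  shows "fplus X \<alpha> \<beta> \<in> B" "ftimes X \<alpha> \<beta> \<in> B" "fmeet X \<alpha> \<beta> \<in> B"
proof -
  have fuzzy: "\<alpha> \<in> fuzzy_sets X" "\<beta> \<in> fuzzy_sets X" if "\<alpha> \<in> B" "\<beta> \<in> B" for \<alpha> \<beta>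
    using that B by (auto simp: mv_subalgebra_def)
  have neg: "fneg X \<alpha> \<in> B" if "\<alpha> \<in> B" for \<alpha>
    using that B by (auto simp: mv_subalgebra_def)
  have plus: "fplus X \<alpha> \<beta> \<in> B" if "\<alpha> \<in> B" "\<beta> \<in> B" for \<alpha> \<beta>
    using that B by (auto simp: mv_subalgebra_def)
  have times: "ftimes X \<alpha> \<beta> \<in> B" if "\<alpha> \<in> B" "\<beta> \<in> B" for \<alpha> \<beta>
  proof -
    have "ftimes X \<alpha> \<beta> = fneg X (fplus X (fneg X \<alpha>) (fneg X \<beta>))"
      using that by (simp add: fuzzy_de_morgan fneg_fneg fuzzy)
    then show ?thesis using that by (simp add: neg plus)
  qed
  \<comment> \<open>The divisibility identity of MV-algebras.\<close>
  have "fmeet X \<alpha> \<beta> = ftimes X \<alpha> (fplus X (fneg X \<alpha>) \<beta>)"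
    using fuzzy_sets_range[OF fuzzy(1)[OF assms(2,3)]] fuzzy_sets_range[OF fuzzy(2)[OF assms(2,3)]]
    by (force simp: fuzzy_op_defs min_def max_def fun_eq_iff restrict_def)
  then show "fplus X \<alpha> \<beta> \<in> B" "ftimes X \<alpha> \<beta> \<in> B" "fmeet X \<alpha> \<beta> \<in> B"
    using assms neg plus times by simp_all
qed

text \<open>
  A monotone continuous function commutes with suprema in each variable separately, which
  gives the supremum over all pairs.
\<close>

lemma Sup_mono_binop:
  fixes op :: "real \<Rightarrow> real \<Rightarrow> real"
  assumes mono: "\<And>y. mono (\<lambda>x. op x y)" "\<And>x. mono (op x)"
    and cont: "\<And>y. continuous_on UNIV (\<lambda>x. op x y)" "\<And>x. continuous_on UNIV (op x)"
    and P: "P \<noteq> {}" "bdd_above P" and Q: "Q \<noteq> {}" "bdd_above Q"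
  shows "op (Sup P) (Sup Q) = (SUP (p, q)\<in>P \<times> Q. op p q)"
proof (rule antisym)
  have le: "op p q \<le> op (Sup P) (Sup Q)" if "p \<in> P" "q \<in> Q" for p q
    using that P Q monoD[OF mono(1), of p "Sup P" q] monoD[OF mono(2), of q "Sup Q" "Sup P"]
    by (auto intro: cSup_upper order_trans)
  then have bdd: "bdd_above ((\<lambda>(p, q). op p q) ` (P \<times> Q))"
    by (auto intro!: bdd_aboveI)
  have cont_at: "continuous (at_left x) (\<lambda>x. op x y)" "continuous (at_left y) (op x)" for x y
    using cont by (auto simp: continuous_on_eq_continuous_at intro: continuous_at_imp_continuous_at_within)
  have "op (Sup P) (Sup Q) = (SUP p\<in>P. op p (Sup Q))"
    using continuous_at_Sup_mono[OF mono(1) cont_at(1) P] .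
  also have "\<dots> = (SUP p\<in>P. SUP q\<in>Q. op p q)"
    using continuous_at_Sup_mono[OF mono(2) cont_at(2) Q] by simp
  also have "\<dots> \<le> (SUP (p, q)\<in>P \<times> Q. op p q)"
    using P Q by (intro cSUP_least cSUP_upper2[OF bdd]) auto
  finally show "op (Sup P) (Sup Q) \<le> (SUP (p, q)\<in>P \<times> Q. op p q)" .
  show "(SUP (p, q)\<in>P \<times> Q. op p q) \<le> op (Sup P) (Sup Q)"
    using P Q le by (intro cSUP_least) auto
qed

text \<open>
  The universal property of the join. The bound \<open>c\<close> is nonnegative because the empty join is \<open>0\<close>.
\<close>

lemma fSup_le_iff:
  assumes "S \<subseteq> fuzzy_sets X" "x \<in> X" "0 \<le> c"
  shows "fSup X S x \<le> c \<longleftrightarrow> (\<forall>\<alpha>\<in>S. \<alpha> x \<le> c)"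
proof -
  have "bdd_above (insert 0 ((\<lambda>\<alpha>. \<alpha> x) ` S))"
    using assms(1) fuzzy_sets_range[OF _ assms(2)] by (intro bdd_aboveI[where M = 1]) auto
  then show ?thesis
    using assms(2,3) by (simp add: fSup_def cSup_le_iff)
qed

lemma fSup_fSup:
  assumes "\<And>i. i \<in> I \<Longrightarrow> T i \<subseteq> fuzzy_sets X"
  shows "fSup X ((\<lambda>i. fSup X (T i)) ` I) = fSup X (\<Union>i\<in>I. T i)"
proof (rule fuzzy_set_eqI[of _ X])
  show inner: "fSup X ((\<lambda>i. fSup X (T i)) ` I) \<in> fuzzy_sets X"
    using assms by (intro fSup_fuzzy_sets) (auto intro: subsetD[OF _ fSup_fuzzy_sets] fSup_fuzzy_sets)
  show union: "fSup X (\<Union>i\<in>I. T i) \<in> fuzzy_sets X"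
    using assms by (intro fSup_fuzzy_sets) auto
  fix x assume x: "x \<in> X"
  have "fSup X ((\<lambda>i. fSup X (T i)) ` I) x \<le> c \<longleftrightarrow> fSup X (\<Union>i\<in>I. T i) x \<le> c" if "0 \<le> c" for c
    using assms x that by (subst (1 2) fSup_le_iff) (auto simp: fSup_le_iff fSup_fuzzy_sets)
  then show "fSup X ((\<lambda>i. fSup X (T i)) ` I) x = fSup X (\<Union>i\<in>I. T i) x"
    using fuzzy_sets_range[OF inner x] fuzzy_sets_range[OF union x] by (meson order.antisym order.refl)
qed

text \<open>
  Distributivity of a pointwise operation over joins: the value at two joins of members of \<open>B\<close> is
  the join of the values at pairs of members.
\<close>

lemma topology_of_base_binop:
  fixes op :: "real \<Rightarrow> real \<Rightarrow> real"
  assumes mono: "\<And>y. mono (\<lambda>x. op x y)" "\<And>x. mono (op x)"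
    and cont: "\<And>y. continuous_on UNIV (\<lambda>x. op x y)" "\<And>x. continuous_on UNIV (op x)"
    and zero: "op 0 0 = 0"
    and B: "B \<subseteq> fuzzy_sets X" "fconst X 0 \<in> B"
      "\<And>\<alpha> \<beta>. \<alpha> \<in> B \<Longrightarrow> \<beta> \<in> B \<Longrightarrow> (\<lambda>x\<in>X. op (\<alpha> x) (\<beta> x)) \<in> B"
    and "\<alpha> \<in> topology_of_base X B" "\<beta> \<in> topology_of_base X B"
  shows "(\<lambda>x\<in>X. op (\<alpha> x) (\<beta> x)) \<in> topology_of_base X B"
proof -
  obtain S T where ST: "S \<subseteq> B" "T \<subseteq> B" "\<alpha> = fSup X S" "\<beta> = fSup X T"
    using assms by (auto simp: topology_of_base_def)
  \<comment> \<open>Adding the constant \<open>0\<close> does not change a join. Without it, an empty \<open>S\<close> or \<open>T\<close> would leave no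
    pairs, and the values of \<open>op\<close> at \<open>0\<close> and the other argument would be missed.\<close>
  define S0 T0 where "S0 = insert (fconst X 0) S" and "T0 = insert (fconst X 0) T"
  define U where "U = (\<lambda>(\<alpha>, \<beta>). \<lambda>x\<in>X. op (\<alpha> x) (\<beta> x)) ` (S0 \<times> T0)"
  have "(\<lambda>x\<in>X. op (\<alpha> x) (\<beta> x)) = fSup X U"
    unfolding fSup_def[of X U]
  proof (rule restrict_ext)
    fix x assume x: "x \<in> X"
    let ?P = "insert 0 ((\<lambda>\<alpha>. \<alpha> x) ` S)" and ?Q = "insert 0 ((\<lambda>\<alpha>. \<alpha> x) ` T)"
    have bdd: "bdd_above ?P" "bdd_above ?Q"
      using ST(1,2) B(1) fuzzy_sets_range[OF _ x] by (auto intro!: bdd_aboveI[where M = 1])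
    have PQ: "?P = (\<lambda>\<alpha>. \<alpha> x) ` S0" "?Q = (\<lambda>\<alpha>. \<alpha> x) ` T0"
      using x by (auto simp: S0_def T0_def fconst_def)
    have "(\<lambda>\<alpha>. \<alpha> x) ` U = (\<lambda>(p, q). op p q) ` (?P \<times> ?Q)"
      unfolding PQ U_def using x by (force simp: image_iff)
    moreover have "0 \<in> (\<lambda>(p, q). op p q) ` (?P \<times> ?Q)"
      using zero by (auto intro!: image_eqI[where x = "(0, 0)"])
    ultimately have "insert 0 ((\<lambda>\<alpha>. \<alpha> x) ` U) = (\<lambda>(p, q). op p q) ` (?P \<times> ?Q)"
      by (simp add: insert_absorb)
    then show "op (\<alpha> x) (\<beta> x) = Sup (insert 0 ((\<lambda>\<alpha>. \<alpha> x) ` U))"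
      using Sup_mono_binop[of op ?P ?Q, OF mono cont _ bdd(1) _ bdd(2)] x
      by (simp add: ST fSup_def)
  qed
  moreover have "U \<subseteq> B"
    using ST(1,2) B(2) by (auto simp: U_def S0_def T0_def intro!: B(3))
  ultimately show ?thesis by (auto simp: topology_of_base_def)
qed

lemma mv_topology_topology_of_base:
  assumes B: "mv_subalgebra X B"
  shows "mv_topology X (topology_of_base X B)"
proof -
  have fuzzy: "B \<subseteq> fuzzy_sets X" and zero: "fconst X 0 \<in> B" and one: "fconst X 1 \<in> B"
    using B fuzzy_de_morgan(5)[of X] by (auto simp: mv_subalgebra_def)
  have base: "B \<subseteq> topology_of_base X B"
    using mv_base_topology_of_base[OF fuzzy] by (simp add: mv_base_def)
  have "fSup X S \<in> topology_of_base X B" if S: "S \<subseteq> topology_of_base X B" for S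
  proof -
    obtain T where T: "\<And>\<alpha>. \<alpha> \<in> S \<Longrightarrow> T \<alpha> \<subseteq> B \<and> \<alpha> = fSup X (T \<alpha>)"
      using S unfolding topology_of_base_def subset_iff mem_Collect_eq by metis
    have "S = (\<lambda>\<alpha>. fSup X (T \<alpha>)) ` S"
      using T by force
    then have "fSup X S = fSup X (\<Union>\<alpha>\<in>S. T \<alpha>)"
      using fSup_fSup[of S T X] T fuzzy by (metis order_trans)
    then show ?thesis
      using T by (auto simp: topology_of_base_def)
  qed
  moreover have "fplus X \<alpha> \<beta> \<in> topology_of_base X B" "ftimes X \<alpha> \<beta> \<in> topology_of_base X B"
    "fmeet X \<alpha> \<beta> \<in> topology_of_base X B"
    if "\<alpha> \<in> topology_of_base X B" "\<beta> \<in> topology_of_base X B" for \<alpha> \<beta>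
    unfolding fplus_def ftimes_def fmeet_def mv_plus_def mv_times_def
    by (rule topology_of_base_binop[OF _ _ _ _ _ fuzzy zero _ that];
        use mv_subalgebra_closed[OF B] in
          \<open>auto intro!: monoI continuous_intros simp: fplus_def ftimes_def fmeet_def mv_plus_def mv_times_def\<close>)+
  moreover have "topology_of_base X B \<subseteq> fuzzy_sets X"
    using fuzzy by (auto simp: topology_of_base_def intro!: fSup_fuzzy_sets)
  ultimately show ?thesis
    using base zero one by (auto simp: mv_topology_def)
qed

section \<open>The space of homomorphisms\<close>

lemma Upsilon_simps [simp]:
  "pts (Upsilon A) = H_set A"
  "opens (Upsilon A) = topology_of_base (H_set A) (Upsilon_base A)"
  "ple (Upsilon A) = H_le A"
  by (simp_all add: Upsilon_def)

lemma mv_lattice_closed: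
  assumes "mv_lattice A"
  shows "lzero A \<in> lcarrier A" "lone A \<in> lcarrier A"
    "\<And>a b. a \<in> lcarrier A \<Longrightarrow> b \<in> lcarrier A \<Longrightarrow> ljoin A a b \<in> lcarrier A"
    "\<And>a b. a \<in> lcarrier A \<Longrightarrow> b \<in> lcarrier A \<Longrightarrow> lmeet A a b \<in> lcarrier A"
    "\<And>a b. a \<in> lcarrier A \<Longrightarrow> b \<in> lcarrier A \<Longrightarrow> ladd A a b \<in> lcarrier A"
    "\<And>a b. a \<in> lcarrier A \<Longrightarrow> b \<in> lcarrier A \<Longrightarrow> lmul A a b \<in> lcarrier A"
  using assms by (simp_all add: mv_lattice_def bounded_distrib_lattice_on_def)

lemma H_set_iff:
  "h \<in> H_set A \<longleftrightarrow> h \<in> lcarrier A \<rightarrow>\<^sub>E {0..1} \<and> h (lzero A) = 0 \<and> h (lone A) = 1 \<and>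
    (\<forall>a\<in>lcarrier A. \<forall>b\<in>lcarrier A.
       h (ljoin A a b) = max (h a) (h b) \<and> h (lmeet A a b) = min (h a) (h b) \<and>
       h (ladd A a b) = mv_plus (h a) (h b) \<and> h (lmul A a b) = mv_times (h a) (h b))"
  by (auto simp: H_set_def mvl_hom_def unit_interval_mvl_def)

lemma tilde_fuzzy_sets: "a \<in> lcarrier A \<Longrightarrow> tilde A a \<in> fuzzy_sets (H_set A)"
  by (auto simp: tilde_def fuzzy_sets_def H_set_iff dest!: PiE_mem)

lemma mv_subalgebra_Upsilon_base: "mv_subalgebra (H_set A) (Upsilon_base A)"
  and tilde_Upsilon_base: "a \<in> lcarrier A \<Longrightarrow> tilde A a \<in> Upsilon_base A"
proof -
  have "mv_subalgebra (H_set A) (fuzzy_sets (H_set A))"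
    by (auto simp: mv_subalgebra_def fuzzy_sets_closed fconst_fuzzy_sets)
  then have "Upsilon_base A \<subseteq> fuzzy_sets (H_set A)"
    unfolding Upsilon_base_def by (intro hull_minimal) (auto simp: tilde_fuzzy_sets)
  \<comment> \<open>Being contained in \<open>fuzzy_sets\<close> is not inherited by the empty intersection, so stability of
    MV-subalgebras under intersection needs the one subalgebra that was just exhibited.\<close>
  then show "mv_subalgebra (H_set A) (Upsilon_base A)"
    unfolding mv_subalgebra_def by (auto simp: Upsilon_base_def hull_def mv_subalgebra_def)
  show "a \<in> lcarrier A \<Longrightarrow> tilde A a \<in> Upsilon_base A"
    unfolding Upsilon_base_def by (intro hull_inc) auto
qed

text \<open>
  The pointwise order is antisymmetric because homomorphisms are extensional functions on the carrier.
\<close>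

lemma pomv_space_Upsilon: "pomv_space (Upsilon A)"
proof -
  have "partial_order_on (H_set A) (H_le A)"
    unfolding partial_order_on_def preorder_on_def
  proof (intro conjI)
    show "antisym (H_le A)"
    proof (rule antisymI)
      fix f g assume "(f, g) \<in> H_le A" "(g, f) \<in> H_le A"
      then show "f = g"
        by (intro PiE_ext[of f "lcarrier A" "\<lambda>_. {0..1}"]) (auto simp: H_le_def H_set_iff intro: antisym)
    qed
  qed (auto simp: H_le_def refl_on_def intro!: transI intro: order_trans)
  then show ?thesis
    by (simp add: pomv_space_def mv_topology_topology_of_base mv_subalgebra_Upsilon_base)
qed

lemma tilde_mv_clopens:
  assumes "a \<in> lcarrier A"
  shows "tilde A a \<in> mv_clopens (H_set A) (topology_of_base (H_set A) (Upsilon_base A))"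
proof -
  note sub = mv_subalgebra_Upsilon_base[of A]
  have "Upsilon_base A \<subseteq> topology_of_base (H_set A) (Upsilon_base A)"
    using mv_base_topology_of_base[of "Upsilon_base A" "H_set A"] sub
    by (simp add: mv_base_def mv_subalgebra_def)
  moreover have "tilde A a \<in> Upsilon_base A" "fneg (H_set A) (tilde A a) \<in> Upsilon_base A"
    using assms sub by (auto simp: tilde_Upsilon_base mv_subalgebra_def)
  ultimately show ?thesis
    using mv_clopens_iff[OF mv_topology_topology_of_base[OF sub]] by auto
qed

section \<open>The MV-lattice of increasing clopens\<close>

lemma Clop_simps [simp]:
  "ladd (Clop X) = fplus (pts X)" "lmul (Clop X) = ftimes (pts X)"
  "ljoin (Clop X) = fjoin (pts X)" "lmeet (Clop X) = fmeet (pts X)"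
  "lzero (Clop X) = fconst (pts X) 0" "lone (Clop X) = fconst (pts X) 1"
  by (simp_all add: Clop_def)

lemma lcarrier_Clop: "lcarrier (Clop X) = {\<alpha> \<in> mv_clopens (pts X) (opens X). increasing X \<alpha>}"
  by (simp add: Clop_def)

lemma increasing_closed:
  assumes "ple X \<subseteq> pts X \<times> pts X" "increasing X \<alpha>" "increasing X \<beta>"
  shows "increasing X (fplus (pts X) \<alpha> \<beta>)" "increasing X (ftimes (pts X) \<alpha> \<beta>)"
    "increasing X (fjoin (pts X) \<alpha> \<beta>)" "increasing X (fmeet (pts X) \<alpha> \<beta>)"
proof -
  have "(x, y) \<in> ple X \<Longrightarrow> x \<in> pts X \<and> y \<in> pts X \<and> \<alpha> x \<le> \<alpha> y \<and> \<beta> x \<le> \<beta> y" for x y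
    using assms by (auto simp: increasing_def)
  then show "increasing X (fplus (pts X) \<alpha> \<beta>)" "increasing X (ftimes (pts X) \<alpha> \<beta>)"
    "increasing X (fjoin (pts X) \<alpha> \<beta>)" "increasing X (fmeet (pts X) \<alpha> \<beta>)"
    unfolding increasing_def by (fastforce simp: fuzzy_op_defs min_def max_def)+
qed

lemma pomv_space_ple: "pomv_space X \<Longrightarrow> ple X \<subseteq> pts X \<times> pts X"
  using partial_order_onD(4) by (auto simp: pomv_space_def)

lemma pomv_space_top: "pomv_space X \<Longrightarrow> mv_topology (pts X) (opens X)"
  by (simp add: pomv_space_def)

lemma increasing_fconst: "ple X \<subseteq> pts X \<times> pts X \<Longrightarrow> increasing X (fconst (pts X) c)"
  by (auto simp: increasing_def fconst_def)

lemma Clop_fuzzy_sets: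
  "pomv_space X \<Longrightarrow> \<alpha> \<in> lcarrier (Clop X) \<Longrightarrow> \<alpha> \<in> fuzzy_sets (pts X)"
  using mv_topology_fuzzy[OF pomv_space_top] by (auto simp: lcarrier_Clop mv_clopens_iff[OF pomv_space_top])

lemma Clop_closed:
  assumes "pomv_space X" "\<alpha> \<in> lcarrier (Clop X)" "\<beta> \<in> lcarrier (Clop X)"
  shows "fplus (pts X) \<alpha> \<beta> \<in> lcarrier (Clop X)" "ftimes (pts X) \<alpha> \<beta> \<in> lcarrier (Clop X)"
    "fjoin (pts X) \<alpha> \<beta> \<in> lcarrier (Clop X)" "fmeet (pts X) \<alpha> \<beta> \<in> lcarrier (Clop X)"
  using assms mv_clopens_closed[OF pomv_space_top[OF assms(1)]]
    increasing_closed[OF pomv_space_ple[OF assms(1)]]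
  by (simp_all add: lcarrier_Clop)

text \<open>
  Every identity holds pointwise. Neutrality of the bounds and the comparison of the product with
  the meet rely on values in \<open>[0,1]\<close>; the other identities hold for all reals.
\<close>

lemma mv_lattice_Clop:
  assumes X: "pomv_space X"
  shows "mv_lattice (Clop X)"
proof -
  have bounds: "fconst (pts X) 0 \<in> lcarrier (Clop X)" "fconst (pts X) 1 \<in> lcarrier (Clop X)"
    using fconst_mv_clopens[OF pomv_space_top[OF X]] increasing_fconst[OF pomv_space_ple[OF X]]
    by (simp_all add: lcarrier_Clop)
  note closed = Clop_closed[OF X] bounds
  have eqI: "\<alpha> = \<beta>" if "\<alpha> \<in> lcarrier (Clop X)" "\<beta> \<in> lcarrier (Clop X)"
      "\<And>x. x \<in> pts X \<Longrightarrow> \<alpha> x = \<beta> x" for \<alpha> \<beta>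
    using that Clop_fuzzy_sets[OF X] fuzzy_set_eqI by metis
  have app: "fplus (pts X) \<alpha> \<beta> x = mv_plus (\<alpha> x) (\<beta> x)" "ftimes (pts X) \<alpha> \<beta> x = mv_times (\<alpha> x) (\<beta> x)"
    "fjoin (pts X) \<alpha> \<beta> x = max (\<alpha> x) (\<beta> x)" "fmeet (pts X) \<alpha> \<beta> x = min (\<alpha> x) (\<beta> x)"
    "fconst (pts X) c x = c" if "x \<in> pts X" for x \<alpha> \<beta> c
    using that by (simp_all add: fuzzy_op_defs)
  have bnd: "0 \<le> \<alpha> x" "\<alpha> x \<le> 1" if "\<alpha> \<in> lcarrier (Clop X)" "x \<in> pts X" for \<alpha> x
    using fuzzy_sets_range[OF Clop_fuzzy_sets[OF X that(1)] that(2)] by simp_all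
  have meet: "max (mv_times s t) (min s t) = min s t" if "0 \<le> s" "s \<le> 1" "0 \<le> t" "t \<le> 1" for s t
    using that by (auto simp: mv_times_def max_def min_def)
  have distrib: "mv_plus s (max t u) = max (mv_plus s t) (mv_plus s u)"
    "mv_plus s (min t u) = min (mv_plus s t) (mv_plus s u)"
    "mv_times s (max t u) = max (mv_times s t) (mv_times s u)"
    "mv_times s (min t u) = min (mv_times s t) (mv_times s u)"
    "min s (max t u) = max (min s t) (min s u)"
    for s t u
    by (auto simp: mv_plus_def mv_times_def max_def min_def)
  have comm: "mv_plus s t = mv_plus t s" "mv_times s t = mv_times t s" "max s t = max t s" "min s t = min t s"
    for s t
    by (auto simp: mv_plus_def mv_times_def)
  have absorb: "max s (min s t) = s" "min s (max s t) = s" for s t :: real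
    by (auto simp: max_def min_def)
  have neutral: "mv_plus s 0 = s" "mv_times s 1 = s" "max 0 s = s" "min 1 s = s"
    if "0 \<le> s" "s \<le> 1" for s
    using that by (auto simp: mv_plus_def mv_times_def)
  show ?thesis
    unfolding mv_lattice_def bounded_distrib_lattice_on_def Clop_simps
    \<comment> \<open>Commutativity comes last and as a rule: rewriting with it would reorder operands, and the
      laws for neutral elements would no longer match.\<close>
    by (intro conjI ballI; (simp only: closed; fail)?; rule eqI;
        (simp only: closed app bnd meet distrib absorb neutral max.assoc min.assoc; fail)?;
        simp only: closed app; rule comm)
qed

section \<open>Exchanging points and lattice elements\<close>

lemma compose_fuzzy_ops:
  assumes "f \<in> X \<rightarrow> Y"
  shows "compose X (fconst Y c) f = fconst X c"
    "compose X (fneg Y \<alpha>) f = fneg X (compose X \<alpha> f)"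
    "compose X (fplus Y \<alpha> \<beta>) f = fplus X (compose X \<alpha> f) (compose X \<beta> f)"
    "compose X (fSup Y S) f = fSup X ((\<lambda>\<alpha>. compose X \<alpha> f) ` S)"
  unfolding fuzzy_op_defs compose_def
  by (rule restrict_ext, use assms in \<open>simp add: image_image Pi_iff\<close>)+

text \<open>
  Continuity into \<open>Upsilon A\<close> can be tested on the generators, if their preimages are required to be
  clopen: openness alone would not pass to the negations in the generated subalgebra.
\<close>

lemma continuous_into_Upsilon:
  assumes top: "mv_topology X \<tau>" and f: "f \<in> X \<rightarrow> H_set A"
    and gen: "\<And>a. a \<in> lcarrier A \<Longrightarrow> compose X (tilde A a) f \<in> mv_clopens X \<tau>"
    and \<alpha>: "\<alpha> \<in> topology_of_base (H_set A) (Upsilon_base A)"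
  shows "compose X \<alpha> f \<in> \<tau>"
proof -
  let ?B = "{\<beta> \<in> fuzzy_sets (H_set A). compose X \<beta> f \<in> mv_clopens X \<tau>}"
  have "mv_subalgebra (H_set A) ?B"
    using mv_subalgebra_mv_clopens[OF top]
    by (auto simp: mv_subalgebra_def compose_fuzzy_ops[OF f] fuzzy_sets_closed fconst_fuzzy_sets)
  then have base: "Upsilon_base A \<subseteq> ?B"
    unfolding Upsilon_base_def using gen by (intro hull_minimal) (auto simp: tilde_fuzzy_sets)
  obtain S where S: "S \<subseteq> Upsilon_base A" "\<alpha> = fSup (H_set A) S"
    using \<alpha> by (auto simp: topology_of_base_def)
  have "(\<lambda>\<beta>. compose X \<beta> f) ` S \<subseteq> \<tau>"
    using S(1) base mv_clopens_iff[OF top] by auto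
  then show ?thesis
    using top by (simp add: S(2) compose_fuzzy_ops[OF f] mv_topology_def)
qed

definition swap_args :: "'a set \<Rightarrow> 'b set \<Rightarrow> ('b \<Rightarrow> 'a \<Rightarrow> real) \<Rightarrow> 'a \<Rightarrow> 'b \<Rightarrow> real" where
  "swap_args X A q = (\<lambda>x\<in>X. \<lambda>a\<in>A. q a x)"

text \<open>
  Both levels of currying must be extensional, as the swap restricts each argument to its set.
\<close>

lemma swap_args_swap_args:
  assumes "q \<in> A \<rightarrow>\<^sub>E (X \<rightarrow>\<^sub>E R)"
  shows "swap_args A X (swap_args X A q) = q"
proof (rule PiE_ext[of _ A "\<lambda>_. X \<rightarrow>\<^sub>E R"])
  have q: "q a \<in> X \<rightarrow>\<^sub>E R" if "a \<in> A" for a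
    using assms that by (rule PiE_mem)
  show swap: "swap_args A X (swap_args X A q) a = q a" if "a \<in> A" for a
    using that PiE_restrict[OF q[OF that]] by (simp add: swap_args_def cong: restrict_cong)
  show "swap_args A X (swap_args X A q) \<in> A \<rightarrow>\<^sub>E (X \<rightarrow>\<^sub>E R)"
  proof (rule PiE_I)
    show "swap_args A X (swap_args X A q) a \<in> X \<rightarrow>\<^sub>E R" if "a \<in> A" for a
      unfolding swap[OF that] by (rule q[OF that])
  qed (simp add: swap_args_def)
qed (rule assms)

lemma mvl_hom_Clop_curried:
  assumes "pomv_space X" "q \<in> mvl_hom A (Clop X)"
  shows "q \<in> lcarrier A \<rightarrow>\<^sub>E (pts X \<rightarrow>\<^sub>E {0..1})"
proof -
  have "q \<in> lcarrier A \<rightarrow>\<^sub>E lcarrier (Clop X)"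
    using assms(2) by (simp add: mvl_hom_def)
  also have "\<dots> \<subseteq> lcarrier A \<rightarrow>\<^sub>E fuzzy_sets (pts X)"
    using Clop_fuzzy_sets[OF assms(1)] by (intro PiE_mono) blast
  finally show ?thesis by (simp only: fuzzy_sets_def)
qed

lemma pomv_hom_Upsilon_curried:
  assumes "f \<in> pomv_hom X (Upsilon A)"
  shows "f \<in> pts X \<rightarrow>\<^sub>E (lcarrier A \<rightarrow>\<^sub>E {0..1})"
proof -
  have "f \<in> pts X \<rightarrow>\<^sub>E H_set A"
    using assms by (simp add: pomv_hom_def)
  also have "\<dots> \<subseteq> pts X \<rightarrow>\<^sub>E (lcarrier A \<rightarrow>\<^sub>E {0..1})"
    by (intro PiE_mono) (simp add: H_set_iff subset_iff)
  finally show ?thesis .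
qed

lemma swap_args_pomv_hom:
  assumes X: "pomv_space X" and A: "mv_lattice A" and q: "q \<in> mvl_hom A (Clop X)"
  shows "swap_args (pts X) (lcarrier A) q \<in> pomv_hom X (Upsilon A)"
proof -
  let ?f = "swap_args (pts X) (lcarrier A) q"
  have qa: "q a \<in> lcarrier (Clop X)" if "a \<in> lcarrier A" for a
    using q that by (auto simp: mvl_hom_def)
  have f: "?f x \<in> H_set A" if "x \<in> pts X" for x
    using q that mv_lattice_closed[OF A] fuzzy_sets_range[OF Clop_fuzzy_sets[OF X qa] that]
    by (simp add: H_set_iff mvl_hom_def swap_args_def)
       (simp add: fconst_def fplus_def ftimes_def fjoin_def fmeet_def)
  have tilde: "compose (pts X) (tilde A a) ?f = q a" if "a \<in> lcarrier A" for a
    using Clop_fuzzy_sets[OF X qa[OF that]] f that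
    by (auto simp: compose_def tilde_def fuzzy_sets_def fun_eq_iff PiE_def extensional_def)
       (simp add: swap_args_def)
  have "compose (pts X) \<alpha> ?f \<in> opens X" if "\<alpha> \<in> opens (Upsilon A)" for \<alpha>
  proof (rule continuous_into_Upsilon[OF pomv_space_top[OF X], of _ A])
    show "?f \<in> pts X \<rightarrow> H_set A" using f by blast
    show "compose (pts X) (tilde A a) ?f \<in> mv_clopens (pts X) (opens X)" if "a \<in> lcarrier A" for a
      unfolding tilde[OF that] using qa[OF that] by (simp add: lcarrier_Clop)
    show "\<alpha> \<in> topology_of_base (H_set A) (Upsilon_base A)" using that by simp
  qed
  moreover have "(?f x, ?f y) \<in> H_le A" if "(x, y) \<in> ple X" for x y
  proof -
    have xy: "x \<in> pts X" "y \<in> pts X" using that pomv_space_ple[OF X] by auto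
    have "q a x \<le> q a y" if "a \<in> lcarrier A" for a
      using qa[OF that] \<open>(x, y) \<in> ple X\<close> by (auto simp: lcarrier_Clop increasing_def)
    then show ?thesis
      using f xy by (simp add: H_le_def) (simp add: swap_args_def)
  qed
  moreover have "?f \<in> pts X \<rightarrow>\<^sub>E H_set A"
    using f by (simp add: PiE_iff) (simp add: swap_args_def)
  ultimately show ?thesis
    by (auto simp: pomv_hom_def)
qed

lemma swap_args_mvl_hom:
  assumes X: "pomv_space X" and A: "mv_lattice A" and f: "f \<in> pomv_hom X (Upsilon A)"
  shows "swap_args (lcarrier A) (pts X) f \<in> mvl_hom A (Clop X)"
proof -
  let ?q = "swap_args (lcarrier A) (pts X) f"
  have fx: "f x \<in> H_set A" if "x \<in> pts X" for x
    using f that by (auto simp: pomv_hom_def)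
  then have fX: "f \<in> pts X \<rightarrow> H_set A" by auto
  have cont: "compose (pts X) \<alpha> f \<in> opens X" if "\<alpha> \<in> opens (Upsilon A)" for \<alpha>
    using f that by (auto simp: pomv_hom_def)
  have "?q a \<in> lcarrier (Clop X)" if a: "a \<in> lcarrier A" for a
  proof -
    \<comment> \<open>As a preimage of the clopen \<open>tilde A a\<close>, the fuzzy set \<open>?q a\<close> is clopen.\<close>
    have tilde: "?q a = compose (pts X) (tilde A a) f"
      using a fx by (auto simp: swap_args_def compose_def tilde_def)
    have "tilde A a \<in> mv_clopens (H_set A) (opens (Upsilon A))"
      using tilde_mv_clopens[OF a] by simp
    then have "?q a \<in> mv_clopens (pts X) (opens X)"
      using cont
      by (simp add: mv_clopens_iff[OF pomv_space_top[OF X]] tilde compose_fuzzy_ops[OF fX, symmetric]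
          mv_clopens_iff[OF mv_topology_topology_of_base[OF mv_subalgebra_Upsilon_base]])
    moreover have "increasing X (?q a)"
      unfolding increasing_def
    proof (clarify)
      fix x y assume xy: "(x, y) \<in> ple X"
      then have "(f x, f y) \<in> H_le A" using f by (auto simp: pomv_hom_def)
      then show "?q a x \<le> ?q a y"
        using a xy pomv_space_ple[OF X] by (auto simp: H_le_def swap_args_def)
    qed
    ultimately show ?thesis by (simp add: lcarrier_Clop)
  qed
  then have "?q \<in> lcarrier A \<rightarrow>\<^sub>E lcarrier (Clop X)"
    by (auto simp: swap_args_def)
  moreover have "?q (lzero A) = lzero (Clop X)" "?q (lone A) = lone (Clop X)"
    using fx mv_lattice_closed[OF A] by (auto simp: swap_args_def fconst_def H_set_iff)
  moreover have "?q (ljoin A a b) = ljoin (Clop X) (?q a) (?q b)"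
    "?q (lmeet A a b) = lmeet (Clop X) (?q a) (?q b)"
    "?q (ladd A a b) = ladd (Clop X) (?q a) (?q b)"
    "?q (lmul A a b) = lmul (Clop X) (?q a) (?q b)" if "a \<in> lcarrier A" "b \<in> lcarrier A" for a b
    using fx mv_lattice_closed[OF A] that
    by (auto simp: swap_args_def fjoin_def fmeet_def fplus_def ftimes_def H_set_iff)
  ultimately show ?thesis by (simp add: mvl_hom_def)
qed

section \<open>Unit, counit and transposition\<close>

lemma pomv_hom_mem: "f \<in> pomv_hom X Y \<Longrightarrow> x \<in> pts X \<Longrightarrow> f x \<in> pts Y"
  by (auto simp: pomv_hom_def)

lemma mvl_hom_mem: "q \<in> mvl_hom A C \<Longrightarrow> a \<in> lcarrier A \<Longrightarrow> q a \<in> lcarrier C"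
  by (auto simp: mvl_hom_def)

lemma H_set_restrict: "h \<in> H_set A \<Longrightarrow> restrict h (lcarrier A) = h"
  by (rule PiE_restrict[of h _ "\<lambda>_. {0..1}"]) (simp add: H_set_iff)

lemma Clop_restrict: "pomv_space X \<Longrightarrow> \<alpha> \<in> lcarrier (Clop X) \<Longrightarrow> restrict \<alpha> (pts X) = \<alpha>"
  by (rule PiE_restrict[of \<alpha> _ "\<lambda>_. {0..1}"]) (drule (1) Clop_fuzzy_sets, simp add: fuzzy_sets_def)

text \<open>
  Unit and counit, and through them the action of the functors on morphisms, are obtained by
  exchanging arguments, so that the two exchange lemmas show that all of them are morphisms.
\<close>

lemma adj_unit_eq_swap: "adj_unit X = swap_args (pts X) (lcarrier (Clop X)) (mvl_id (Clop X))"
  unfolding adj_unit_def swap_args_def mvl_id_def by (intro restrict_ext) simp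

lemma adj_counit_eq_swap: "adj_counit A = swap_args (lcarrier A) (H_set A) (pomv_id (Upsilon A))"
  unfolding adj_counit_def tilde_def swap_args_def pomv_id_def by (intro restrict_ext) simp

lemma adj_unit_hom: "pomv_space X \<Longrightarrow> adj_unit X \<in> pomv_hom X (Upsilon (Clop X))"
  unfolding adj_unit_eq_swap
  by (intro swap_args_pomv_hom mv_lattice_Clop mvl_id_in_hom)

lemma adj_counit_hom: "mv_lattice A \<Longrightarrow> adj_counit A \<in> mvl_hom A (Clop (Upsilon A))"
  using swap_args_mvl_hom[OF pomv_space_Upsilon _ pomv_id_in_hom[OF pomv_space_Upsilon]]
  unfolding adj_counit_eq_swap by simp

lemma adj_unit_in_H_set: "pomv_space X \<Longrightarrow> x \<in> pts X \<Longrightarrow> adj_unit X x \<in> H_set (Clop X)"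
  using pomv_hom_mem[OF adj_unit_hom] by simp

lemma tilde_in_Clop: "mv_lattice A \<Longrightarrow> a \<in> lcarrier A \<Longrightarrow> tilde A a \<in> lcarrier (Clop (Upsilon A))"
  using mvl_hom_mem[OF adj_counit_hom, of A a] by (simp add: adj_counit_def)

lemma Clop_map_eq_swap:
  assumes "f \<in> pomv_hom X Y"
  shows "Clop_map X Y f = swap_args (lcarrier (Clop Y)) (pts X) (compose (pts X) (adj_unit Y) f)"
  unfolding Clop_map_def swap_args_def compose_def
  by (intro restrict_ext) (simp add: adj_unit_def pomv_hom_mem[OF assms])

lemma Upsilon_map_eq_swap:
  assumes "q \<in> mvl_hom A C"
  shows "Upsilon_map A C q = swap_args (H_set C) (lcarrier A) (compose (lcarrier A) (adj_counit C) q)"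
  unfolding Upsilon_map_def swap_args_def compose_def
  by (intro restrict_ext) (simp add: adj_counit_def tilde_def mvl_hom_mem[OF assms])

lemma Clop_map_hom:
  assumes X: "pomv_space X" and Y: "pomv_space Y" and f: "f \<in> pomv_hom X Y"
  shows "Clop_map X Y f \<in> mvl_hom (Clop Y) (Clop X)"
  unfolding Clop_map_eq_swap[OF f]
  using swap_args_mvl_hom[OF X mv_lattice_Clop[OF Y]] pomv_hom_compose[OF X f adj_unit_hom[OF Y]] .

lemma Upsilon_map_hom:
  assumes A: "mv_lattice A" and C: "mv_lattice C" and q: "q \<in> mvl_hom A C"
  shows "Upsilon_map A C q \<in> pomv_hom (Upsilon C) (Upsilon A)"
  unfolding Upsilon_map_eq_swap[OF q]
  using swap_args_pomv_hom[OF pomv_space_Upsilon A] mvl_hom_compose[OF A q adj_counit_hom[OF C]]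
  by simp

lemma Upsilon_map_in_H_set:
  assumes "mv_lattice A" "mv_lattice C" "q \<in> mvl_hom A C" "h \<in> H_set C"
  shows "Upsilon_map A C q h \<in> H_set A"
  using pomv_hom_mem[OF Upsilon_map_hom] assms by fastforce

lemma Clop_map_in_Clop:
  assumes "pomv_space X" "pomv_space Y" "f \<in> pomv_hom X Y" "\<alpha> \<in> lcarrier (Clop Y)"
  shows "Clop_map X Y f \<alpha> \<in> lcarrier (Clop X)"
  using mvl_hom_mem[OF Clop_map_hom] assms by blast

lemma Clop_map_id:
  assumes "pomv_space X"
  shows "Clop_map X X (pomv_id X) = mvl_id (Clop X)"
  unfolding Clop_map_def mvl_id_def
proof (rule restrict_ext)
  fix \<alpha> assume "\<alpha> \<in> lcarrier (Clop X)"
  then show "compose (pts X) \<alpha> (pomv_id X) = \<alpha>"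
    using Clop_restrict[OF assms] by (simp add: compose_def pomv_id_def cong: restrict_cong)
qed

lemma Upsilon_map_id: "Upsilon_map A A (mvl_id A) = pomv_id (Upsilon A)"
  unfolding Upsilon_map_def pomv_id_def Upsilon_simps
  by (rule restrict_ext) (simp add: compose_def mvl_id_def H_set_restrict cong: restrict_cong)

lemma Clop_map_compose:
  assumes "pomv_space Y" "pomv_space Z" "f \<in> pomv_hom X Y" "g \<in> pomv_hom Y Z"
  shows "Clop_map X Z (compose (pts X) g f) =
    compose (lcarrier (Clop Z)) (Clop_map X Y f) (Clop_map Y Z g)"
  unfolding compose_def[of "lcarrier (Clop Z)"]
  using Clop_map_in_Clop[OF assms(1,2,4)] pomv_hom_mem[OF assms(3)]
  by (subst Clop_map_def, intro restrict_ext)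
     (simp add: Clop_map_def compose_def cong: restrict_cong)

lemma Upsilon_map_compose:
  assumes "mv_lattice C" "mv_lattice D" "q \<in> mvl_hom A C" "r \<in> mvl_hom C D"
  shows "Upsilon_map A D (compose (lcarrier A) r q) =
    compose (pts (Upsilon D)) (Upsilon_map A C q) (Upsilon_map C D r)"
  unfolding compose_def[of "pts (Upsilon D)"]
  using Upsilon_map_in_H_set[OF assms(1,2,4)] mvl_hom_mem[OF assms(3)]
  by (subst Upsilon_map_def, unfold Upsilon_simps, intro restrict_ext)
     (simp add: Upsilon_map_def compose_def cong: restrict_cong)

lemma adj_unit_natural:
  assumes "pomv_space X" "pomv_space Y" "f \<in> pomv_hom X Y"
  shows "compose (pts X) (Upsilon_map (Clop Y) (Clop X) (Clop_map X Y f)) (adj_unit X) =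
    compose (pts X) (adj_unit Y) f"
  unfolding compose_def[of "pts X"]
proof (rule restrict_ext)
  fix x assume x: "x \<in> pts X"
  then show "Upsilon_map (Clop Y) (Clop X) (Clop_map X Y f) (adj_unit X x) = adj_unit Y (f x)"
    \<comment> \<open>The value of the outer map depends on \<open>adj_unit X x\<close> being a homomorphism, so that map is
      unfolded first, and the argument only afterwards.\<close>
    using adj_unit_in_H_set[OF assms(1)] Clop_map_in_Clop[OF assms] pomv_hom_mem[OF assms(3)]
    by (simp add: Upsilon_map_def)
       (simp add: adj_unit_def Clop_map_def compose_def cong: restrict_cong)
qed

lemma adj_counit_natural:
  assumes "mv_lattice A" "mv_lattice C" "q \<in> mvl_hom A C"
  shows "compose (lcarrier A) (Clop_map (Upsilon C) (Upsilon A) (Upsilon_map A C q)) (adj_counit A) =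
    compose (lcarrier A) (adj_counit C) q"
  unfolding compose_def[of "lcarrier A"]
proof (rule restrict_ext)
  fix a assume a: "a \<in> lcarrier A"
  then show "Clop_map (Upsilon C) (Upsilon A) (Upsilon_map A C q) (adj_counit A a) = adj_counit C (q a)"
    using tilde_in_Clop[OF assms(1)] Upsilon_map_in_H_set[OF assms] mvl_hom_mem[OF assms(3)]
    by (simp add: Clop_map_def adj_counit_def)
       (simp add: Upsilon_map_def tilde_def compose_def cong: restrict_cong)
qed

lemma triangle_Clop:
  assumes "pomv_space X"
  shows "compose (lcarrier (Clop X)) (Clop_map X (Upsilon (Clop X)) (adj_unit X)) (adj_counit (Clop X)) =
    mvl_id (Clop X)"
  unfolding compose_def[of "lcarrier (Clop X)"] mvl_id_def
proof (rule restrict_ext)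
  fix \<alpha> assume \<alpha>: "\<alpha> \<in> lcarrier (Clop X)"
  have "Clop_map X (Upsilon (Clop X)) (adj_unit X) (adj_counit (Clop X) \<alpha>) = restrict \<alpha> (pts X)"
    using \<alpha> tilde_in_Clop[OF mv_lattice_Clop[OF assms]] adj_unit_in_H_set[OF assms]
    by (simp add: Clop_map_def adj_counit_def)
       (simp add: adj_unit_def tilde_def compose_def cong: restrict_cong)
  then show "Clop_map X (Upsilon (Clop X)) (adj_unit X) (adj_counit (Clop X) \<alpha>) = \<alpha>"
    by (simp add: Clop_restrict[OF assms \<alpha>])
qed

lemma triangle_Upsilon:
  assumes "mv_lattice A"
  shows "compose (pts (Upsilon A)) (Upsilon_map A (Clop (Upsilon A)) (adj_counit A)) (adj_unit (Upsilon A)) =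
    pomv_id (Upsilon A)"
  unfolding Upsilon_simps compose_def[of "H_set A"] pomv_id_def
proof (rule restrict_ext)
  fix h assume h: "h \<in> H_set A"
  have "Upsilon_map A (Clop (Upsilon A)) (adj_counit A) (adj_unit (Upsilon A) h) = restrict h (lcarrier A)"
    using h tilde_in_Clop[OF assms] adj_unit_in_H_set[OF pomv_space_Upsilon[of A]]
    by (simp add: Upsilon_map_def)
       (simp add: adj_unit_def adj_counit_def tilde_def compose_def cong: restrict_cong)
  then show "Upsilon_map A (Clop (Upsilon A)) (adj_counit A) (adj_unit (Upsilon A) h) = h"
    by (simp add: H_set_restrict[OF h])
qed

text \<open>
  Transposing is exchanging the arguments, in both directions, so the two transposition maps are
  mutually inverse.
\<close>

lemma adj_transpose_eq_swap:
  assumes "pomv_space X" "q \<in> mvl_hom A (Clop X)"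
  shows "adj_transpose X A q = swap_args (pts X) (lcarrier A) q"
  unfolding adj_transpose_def swap_args_def compose_def[of "pts X"]
  using adj_unit_in_H_set[OF assms(1)] mvl_hom_mem[OF assms(2)]
  by (intro restrict_ext) (simp add: Upsilon_map_def, simp add: adj_unit_def compose_def cong: restrict_cong)

lemma adj_cotranspose_eq_swap:
  assumes "mv_lattice A" "f \<in> pomv_hom X (Upsilon A)"
  shows "adj_cotranspose X A f = swap_args (lcarrier A) (pts X) f"
  unfolding adj_cotranspose_def swap_args_def compose_def[of "lcarrier A"]
  using tilde_in_Clop[OF assms(1)] pomv_hom_mem[OF assms(2)]
  by (intro restrict_ext) (simp add: Clop_map_def adj_counit_def, simp add: tilde_def compose_def cong: restrict_cong)

lemma adj_cotranspose_hom:
  assumes "pomv_space X" "mv_lattice A" "f \<in> pomv_hom X (Upsilon A)"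
  shows "adj_cotranspose X A f \<in> mvl_hom A (Clop X)"
  using swap_args_mvl_hom[OF assms] by (simp add: adj_cotranspose_eq_swap assms)

lemma adj_transpose_hom:
  assumes "pomv_space X" "mv_lattice A" "q \<in> mvl_hom A (Clop X)"
  shows "adj_transpose X A q \<in> pomv_hom X (Upsilon A)"
  using swap_args_pomv_hom[OF assms] by (simp add: adj_transpose_eq_swap assms)

lemma adj_transpose_cotranspose:
  assumes "pomv_space X" "mv_lattice A" "f \<in> pomv_hom X (Upsilon A)"
  shows "adj_transpose X A (adj_cotranspose X A f) = f"
  using swap_args_swap_args[OF pomv_hom_Upsilon_curried[OF assms(3)]] adj_cotranspose_hom[OF assms]
  by (simp add: adj_transpose_eq_swap adj_cotranspose_eq_swap assms)

lemma adj_cotranspose_transpose: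
  assumes "pomv_space X" "mv_lattice A" "q \<in> mvl_hom A (Clop X)"
  shows "adj_cotranspose X A (adj_transpose X A q) = q"
  using swap_args_swap_args[OF mvl_hom_Clop_curried[OF assms(1,3)]] adj_transpose_hom[OF assms]
  by (simp add: adj_transpose_eq_swap adj_cotranspose_eq_swap assms)

lemma bij_betw_adj_transpose:
  assumes "pomv_space X" "mv_lattice A"
  shows "bij_betw (adj_transpose X A) (mvl_hom A (Clop X)) (pomv_hom X (Upsilon A))"
  using assms
  by (intro bij_betw_byWitness[where f' = "adj_cotranspose X A"])
     (auto simp: adj_transpose_cotranspose adj_cotranspose_transpose adj_transpose_hom adj_cotranspose_hom)

lemma adj_transpose_natural:
  assumes X: "pomv_space X" and Y: "pomv_space Y" and A: "mv_lattice A" and C: "mv_lattice C"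
    and q: "q \<in> mvl_hom A (Clop X)" and p: "p \<in> pomv_hom Y X" and r: "r \<in> mvl_hom C A"
  shows "adj_transpose Y C (compose (lcarrier C) (Clop_map Y X p) (compose (lcarrier C) q r)) =
    compose (pts Y) (Upsilon_map C A r) (compose (pts Y) (adj_transpose X A q) p)"
proof -
  have qr: "compose (lcarrier C) q r \<in> mvl_hom C (Clop X)"
    using mvl_hom_compose[OF C r q] .
  have hom: "compose (lcarrier C) (Clop_map Y X p) (compose (lcarrier C) q r) \<in> mvl_hom C (Clop Y)"
    using mvl_hom_compose[OF C qr Clop_map_hom[OF Y X p]] .
  show ?thesis
    unfolding adj_transpose_eq_swap[OF Y hom]
    unfolding swap_args_def compose_def[of "pts Y"]
  proof (rule restrict_ext)
    fix y assume y: "y \<in> pts Y"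
    have "adj_transpose X A q (p y) \<in> H_set A"
      using pomv_hom_mem[OF adj_transpose_hom[OF X A q] pomv_hom_mem[OF p y]] by simp
    then show "(\<lambda>c\<in>lcarrier C. compose (lcarrier C) (Clop_map Y X p) (compose (lcarrier C) q r) c y) =
        Upsilon_map C A r ((\<lambda>y\<in>pts Y. adj_transpose X A q (p y)) y)"
      using y mvl_hom_mem[OF q] mvl_hom_mem[OF r] pomv_hom_mem[OF p]
      by (simp add: Upsilon_map_def)
         (simp add: adj_transpose_eq_swap[OF X q] swap_args_def compose_def Clop_map_def cong: restrict_cong)
  qed
qed

theorem theorem4p5:
  fixes X :: "'a pomv" and Y :: "'b pomv" and Z :: "'c pomv"
    and A :: "'d mvl" and C :: "'e mvl" and D :: "'f mvl"
  assumes "pomv_space X" "pomv_space Y" "pomv_space Z"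
    and "mv_lattice A" "mv_lattice C" "mv_lattice D"
  shows
    "(mv_lattice (Clop X) \<and>
      (\<forall>f\<in>pomv_hom X Y. Clop_map X Y f \<in> mvl_hom (Clop Y) (Clop X)) \<and>
      Clop_map X X (pomv_id X) = mvl_id (Clop X) \<and>
      (\<forall>f\<in>pomv_hom X Y. \<forall>g\<in>pomv_hom Y Z.
         Clop_map X Z (compose (pts X) g f) =
         compose (lcarrier (Clop Z)) (Clop_map X Y f) (Clop_map Y Z g)))
     \<and>
     (pomv_space (Upsilon A) \<and>
      (\<forall>q\<in>mvl_hom A C. Upsilon_map A C q \<in> pomv_hom (Upsilon C) (Upsilon A)) \<and>
      Upsilon_map A A (mvl_id A) = pomv_id (Upsilon A) \<and>
      (\<forall>q\<in>mvl_hom A C. \<forall>r\<in>mvl_hom C D.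
         Upsilon_map A D (compose (lcarrier A) r q) =
         compose (pts (Upsilon D)) (Upsilon_map A C q) (Upsilon_map C D r)))
     \<and>
     (adj_unit X \<in> pomv_hom X (Upsilon (Clop X)) \<and>
      (\<forall>f\<in>pomv_hom X Y.
         compose (pts X) (Upsilon_map (Clop Y) (Clop X) (Clop_map X Y f)) (adj_unit X) =
         compose (pts X) (adj_unit Y) f))
     \<and>
     (adj_counit A \<in> mvl_hom A (Clop (Upsilon A)) \<and>
      (\<forall>q\<in>mvl_hom A C.
         compose (lcarrier A) (Clop_map (Upsilon C) (Upsilon A) (Upsilon_map A C q)) (adj_counit A) =
         compose (lcarrier A) (adj_counit C) q))
     \<and>
     (compose (lcarrier (Clop X)) (Clop_map X (Upsilon (Clop X)) (adj_unit X)) (adj_counit (Clop X)) =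
        mvl_id (Clop X) \<and>
      compose (pts (Upsilon A)) (Upsilon_map A (Clop (Upsilon A)) (adj_counit A)) (adj_unit (Upsilon A)) =
        pomv_id (Upsilon A))
     \<and>
     (bij_betw (adj_transpose X A) (mvl_hom A (Clop X)) (pomv_hom X (Upsilon A)) \<and>
      (\<forall>f\<in>pomv_hom X (Upsilon A).
         adj_cotranspose X A f \<in> mvl_hom A (Clop X) \<and> adj_transpose X A (adj_cotranspose X A f) = f) \<and>
      (\<forall>q\<in>mvl_hom A (Clop X). \<forall>p\<in>pomv_hom Y X. \<forall>r\<in>mvl_hom C A.
         adj_transpose Y C (compose (lcarrier C) (Clop_map Y X p) (compose (lcarrier C) q r)) =
         compose (pts Y) (Upsilon_map C A r) (compose (pts Y) (adj_transpose X A q) p)))"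
  using assms
  by (simp add: mv_lattice_Clop Clop_map_hom Clop_map_id Clop_map_compose
      pomv_space_Upsilon Upsilon_map_hom Upsilon_map_id Upsilon_map_compose
      adj_unit_hom adj_unit_natural adj_counit_hom adj_counit_natural
      triangle_Clop triangle_Upsilon bij_betw_adj_transpose
      adj_cotranspose_hom adj_transpose_cotranspose adj_transpose_natural
      del: Upsilon_simps Clop_simps)

end
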